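(* Let $p\ge5$ be a prime. Then: (1) for every odd $i$ with $0 < i < p-1$, the entry $(i,i)$ of $F(p,-2)$ is zero; (2) for every odd $i$ with $0 < i < p-1$, the entry $(i,p-1-i)$ of $F(p,-2^{-1})$ is zero; (3) for every even $i$ with $0\le i\le p-1$, the entry $(i,i)$ of $F(p,-2)$ and the entry $(i,p-1-i)$ of $F(p,-2^{-1})$ are nonzero.
   Context: For $m\in\mathbb{F}_p$, $F(p,m) = (a_{i,j})_{0\le i,j\le p-1}$ is the $p\times p$ matrix over $\mathbb{F}_p$ with $a_{i,0} = a_{0,j}=1$ and $a_{i,j} = a_{i-1,j} + m\,a_{i-1,j-1} + a_{i,j-1}$ for $i,j\ge1$. Here $-2$ and $-2^{-1}$ are elements of $\mathbb{F}_p$. *)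

theory Defs
  imports "Berlekamp_Zassenhaus.Finite_Field" "Jordan_Normal_Form.Matrix"
begin

fun F_entry :: "'a :: comm_ring_1 \<Rightarrow> nat \<Rightarrow> nat \<Rightarrow> 'a" where
  "F_entry m 0 j = 1"
| "F_entry m (Suc i) 0 = 1"
| "F_entry m (Suc i) (Suc j) = F_entry m i (Suc j) + m * F_entry m i j + F_entry m (Suc i) j"

text \<open>The prime field with \<open>p\<close> elements is \<open>'q mod_ring\<close>, where \<open>'q\<close> is a type of
  prime cardinality \<open>p\<close>; the matrix size \<open>p\<close> has to be tied to \<open>CARD('q)\<close> at the point of use.\<close>

definition F :: "nat \<Rightarrow> 'q :: prime_card mod_ring \<Rightarrow> 'q mod_ring mat" where
  "F p m = mat p p (\<lambda>(i, j). F_entry m i j)"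

end

theory Submission
  imports Defs
begin

text \<open>
  The entry \<open>(i, j)\<close> is \<open>\<Sum>\<^sub>k C(i,k) C(j,k) (1 + m)\<^sup>k\<close>. The diagonal entry \<open>(i, i)\<close> for \<open>m = -2\<close> is
  therefore the coefficient of \<open>x\<^sup>i\<close> in \<open>(1 - x)\<^sup>i (1 + x)\<^sup>i = (1 - x\<^sup>2)\<^sup>i\<close>. In characteristic \<open>p\<close> the
  column \<open>j = p\<close> is constantly 1 on the rows \<open>i < p\<close>, so column \<open>p - 1\<close> is \<open>(-m)\<^sup>i\<close>, and reading the
  recurrence leftwards from there gives \<open>F(p,m)\<^sub>i\<^sub>,\<^sub>p\<^sub>-\<^sub>1\<^sub>-\<^sub>j = (-m)\<^sup>i F(p,m\<^sup>-\<^sup>1)\<^sub>i\<^sub>,\<^sub>j\<close>. With \<open>m = -1/2\<close> this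
  reduces the antidiagonal of \<open>F(p,-1/2)\<close> to the diagonal of \<open>F(p,-2)\<close>.
\<close>

lemma F_entry_eq_sum:
  fixes m :: "'a :: comm_ring_1"
  assumes "i \<le> N"
  shows "F_entry m i j = (\<Sum>k\<le>N. of_nat (i choose k) * of_nat (j choose k) * (1 + m) ^ k)"
  using assms
proof (induction m i j rule: F_entry.induct)
  case (1 m j)
  then show ?case
    by (simp add: sum.atMost_shift)
next
  case (2 m i)
  then show ?case
    by (simp add: sum.atMost_shift)
next
  case (3 m i j)
  let ?term = "\<lambda>i j k. of_nat (i choose k) * of_nat (j choose k) * (1 + m) ^ k"
  obtain M where N_eq: "N = Suc M" and i_le: "i \<le> M"
    using "3.prems" by (cases N) auto
  have term_recurrence: "?term (Suc i) (Suc j) (Suc k) =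
      ?term i (Suc j) (Suc k) + ?term (Suc i) j (Suc k) - ?term i j (Suc k) +
      (1 + m) * ?term i j k" for k
    by (simp add: algebra_simps)
  have "(\<Sum>k\<le>N. ?term (Suc i) (Suc j) k) =
      (\<Sum>k\<le>N. ?term i (Suc j) k) + (\<Sum>k\<le>N. ?term (Suc i) j k) - (\<Sum>k\<le>N. ?term i j k) +
      (1 + m) * (\<Sum>k\<le>M. ?term i j k)"
    unfolding N_eq sum.atMost_Suc_shift term_recurrence
    by (simp add: sum.distrib sum_subtractf sum_distrib_left del: binomial_Suc_Suc)
  also have "(\<Sum>k\<le>M. ?term i j k) = (\<Sum>k\<le>N. ?term i j k)"
    using N_eq i_le by (simp add: binomial_eq_0)
  finally show ?case
    using 3 by (simp add: algebra_simps)
qed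

lemma sum_alternating_choose_square:
  "(\<Sum>k\<le>n. (-1) ^ k * of_nat (n choose k) ^ 2 :: 'a :: comm_ring_1) =
     (if even n then (-1) ^ (n div 2) * of_nat (n choose (n div 2)) else 0)"
proof -
  have "(\<Sum>k\<le>n. (-1) ^ k * of_nat (n choose k) ^ 2 :: 'a) =
      coeff ([:1, -1:] ^ n * [:1, 1:] ^ n) n"
    unfolding coeff_mult
    by (intro sum.cong refl)
       (simp add: coeff_linear_poly_power power2_eq_square mult_ac flip: binomial_symmetric)
  also have "[:1, -1:] ^ n * [:1, 1:] ^ n = (monom (-1 :: 'a) 2 + 1) ^ n"
    by (simp add: monom_altdef one_pCons numeral_2_eq_2 flip: power_mult_distrib)
  also have "\<dots> = (\<Sum>k\<le>n. monom (of_nat (n choose k) * (-1) ^ k) (2 * k))"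
    by (simp add: binomial_ring monom_power of_nat_monom mult_monom mult_ac)
  also have "coeff \<dots> n =
      (\<Sum>k\<le>n. if k = n div 2 \<and> even n then of_nat (n choose k) * (-1) ^ k else 0)"
    by (auto simp: coeff_sum intro!: sum.cong)
  also have "\<dots> = (if even n then (-1) ^ (n div 2) * of_nat (n choose (n div 2)) else 0)"
    by (auto simp: mult_ac)
  finally show ?thesis .
qed

lemma F_entry_neg_two_diag:
  "(F_entry (- 2) i i :: 'a :: comm_ring_1) =
     (if even i then (-1) ^ (i div 2) * of_nat (i choose (i div 2)) else 0)"
proof -
  have "(F_entry (- 2) i i :: 'a) = (\<Sum>k\<le>i. (-1) ^ k * of_nat (i choose k) ^ 2)"
    by (simp add: F_entry_eq_sum[OF order_refl] power2_eq_square mult_ac)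
  then show ?thesis
    by (simp only: sum_alternating_choose_square)
qed

lemma of_nat_choose_neq_0:
  assumes "prime CHAR('a :: semiring_1)" and "n < CHAR('a)" and "k \<le> n"
  shows "(of_nat (n choose k) :: 'a) \<noteq> 0"
proof
  assume "(of_nat (n choose k) :: 'a) = 0"
  then have "CHAR('a) dvd n choose k"
    by (simp add: of_nat_eq_0_iff_char_dvd)
  also have "n choose k dvd fact n"
    using binomial_fact_lemma[OF assms(3)] by (metis dvd_triv_right)
  finally show False
    using assms by (simp add: prime_dvd_fact_iff)
qed

lemma F_entry_neg_two_diag_eq_0_iff:
  assumes "i < CHAR('a :: idom)"
  shows "(F_entry (- 2) i i :: 'a) = 0 \<longleftrightarrow> odd i"
proof -
  have "prime CHAR('a)"
    using assms by (intro prime_CHAR_semidom) simp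
  then show ?thesis
    using of_nat_choose_neq_0[of i "i div 2", where 'a = 'a] assms
    by (simp add: F_entry_neg_two_diag)
qed

lemma F_entry_CHAR:
  fixes m :: "'a :: comm_ring_1"
  assumes "prime CHAR('a)" and "i < CHAR('a)"
  shows "F_entry m i CHAR('a) = 1"
proof -
  have "(of_nat (CHAR('a) choose k) :: 'a) = 0" if "0 < k" "k \<le> i" for k
    using that assms by (simp add: of_nat_eq_0_iff_char_dvd dvd_choose_prime)
  then show ?thesis
    by (simp add: F_entry_eq_sum[OF order_refl] sum.atMost_shift)
qed

lemma F_entry_CHAR_minus_1:
  fixes m :: "'a :: comm_ring_1"
  assumes "prime CHAR('a)" and "i < CHAR('a)"
  shows "F_entry m i (CHAR('a) - 1) = (- m) ^ i"
  using assms(2)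
proof (induction i)
  case (Suc i)
  have "Suc (CHAR('a) - 1) = CHAR('a)"
    using Suc.prems by simp
  then have "F_entry m (Suc i) CHAR('a) =
      F_entry m i CHAR('a) + m * F_entry m i (CHAR('a) - 1) + F_entry m (Suc i) (CHAR('a) - 1)"
    by (metis F_entry.simps(3))
  then have "F_entry m (Suc i) (CHAR('a) - 1) = - (m * F_entry m i (CHAR('a) - 1))"
    using Suc.prems by (simp add: F_entry_CHAR assms(1) eq_neg_iff_add_eq_0 add.commute)
  with Suc show ?case
    by simp
qed simp

lemma F_entry_reflect:
  fixes m m' :: "'a :: comm_ring_1"
  assumes "prime CHAR('a)" and "m * m' = 1" and "i < CHAR('a)" and "j < CHAR('a)"
  shows "F_entry m i (CHAR('a) - 1 - j) = (- m) ^ i * F_entry m' i j"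
  using assms(2-)
proof (induction m' i j rule: F_entry.induct)
  case (2 m' i)
  then show ?case
    using F_entry_CHAR_minus_1[OF assms(1), of "Suc i" m] by simp
next
  case (3 m' i j)
  define col where "col = CHAR('a) - 1 - Suc j"
  have "CHAR('a) - 1 - j = Suc col"
    using "3.prems" by (simp add: col_def)
  with 3 have IH:
    "F_entry m i col = (- m) ^ i * F_entry m' i (Suc j)"
    "F_entry m i (Suc col) = (- m) ^ i * F_entry m' i j"
    "F_entry m (Suc i) (Suc col) = (- m) ^ Suc i * F_entry m' (Suc i) j"
    by (simp_all add: col_def)
  have "F_entry m (Suc i) col =
      F_entry m (Suc i) (Suc col) - F_entry m i (Suc col) - m * F_entry m i col"
    by simp
  also have "\<dots> =
      (- m) ^ Suc i * F_entry m' (Suc i) j - (m * m') * ((- m) ^ i * F_entry m' i j) -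
      m * ((- m) ^ i * F_entry m' i (Suc j))"
    by (simp only: IH "3.prems"(1) mult_1)
  also have "\<dots> = (- m) ^ Suc i * F_entry m' (Suc i) (Suc j)"
    by (simp add: algebra_simps)
  finally show ?case
    by (simp only: col_def)
qed simp

lemma F_entry_neg_half_antidiag_eq_0_iff:
  assumes "(2 :: 'a :: field) \<noteq> 0" and "i < CHAR('a)"
  shows "(F_entry (- inverse 2) i (CHAR('a) - 1 - i) :: 'a) = 0 \<longleftrightarrow> odd i"
proof -
  have "prime CHAR('a)"
    using assms(2) by (intro prime_CHAR_semidom) simp
  then have "(F_entry (- inverse 2) i (CHAR('a) - 1 - i) :: 'a) = inverse 2 ^ i * F_entry (- 2) i i"
    using F_entry_reflect[of "- inverse 2 :: 'a" "- 2" i i] assms by simp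
  then show ?thesis
    using assms by (simp add: F_entry_neg_two_diag_eq_0_iff)
qed

theorem theorem5p4:
  fixes p :: nat
  assumes "prime p" and "p \<ge> 5" and "CARD('q :: prime_card) = p"
  shows "(\<forall>i. odd i \<and> 0 < i \<and> i < p - 1 \<longrightarrow>
            F p (- 2 :: 'q mod_ring) $$ (i, i) = 0) \<and>
         (\<forall>i. odd i \<and> 0 < i \<and> i < p - 1 \<longrightarrow>
            F p (- inverse 2 :: 'q mod_ring) $$ (i, p - 1 - i) = 0) \<and>
         (\<forall>i. even i \<and> 0 \<le> i \<and> i \<le> p - 1 \<longrightarrow>
            F p (- 2 :: 'q mod_ring) $$ (i, i) \<noteq> 0 \<and>
            F p (- inverse 2 :: 'q mod_ring) $$ (i, p - 1 - i) \<noteq> 0)"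
proof -
  have char_eq: "CHAR('q mod_ring) = p"
    using assms(3) by simp
  have two_neq_0: "(2 :: 'q mod_ring) \<noteq> 0"
    using of_nat_eq_0_iff_char_dvd[of 2, where 'a = "'q mod_ring"] assms(2) char_eq
    by (auto dest: dvd_imp_le)
  have diag: "F p (- 2 :: 'q mod_ring) $$ (i, i) = 0 \<longleftrightarrow> odd i" if "i < p" for i
    using that F_entry_neg_two_diag_eq_0_iff[of i, where 'a = "'q mod_ring"] char_eq
    by (simp add: F_def)
  have antidiag: "F p (- inverse 2 :: 'q mod_ring) $$ (i, p - 1 - i) = 0 \<longleftrightarrow> odd i"
    if "i < p" for i
    using that F_entry_neg_half_antidiag_eq_0_iff[OF two_neq_0, of i] char_eq
    by (simp add: F_def)
  have "i < p" if "i \<le> p - 1" for i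
    using that assms(2) by linarith
  with diag antidiag show ?thesis
    by simp
qed

end
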